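(* Let $\mathrm{RelASC}$ be the category of abstract simplicial complexes and simplicial relations, and let $\mathrm{ASC}_{\mathscr{I}}$ be the Kleisli category of the monad $\mathscr{I}$ on the category $\mathrm{ASC}$ of abstract simplicial complexes and simplicial maps. There is an equivalence of categories between $\mathrm{RelASC}$ and $\mathrm{ASC}_{\mathscr{I}}$, given by the functor $(\cdot)^+:\mathrm{RelASC}\to\mathrm{ASC}_{\mathscr{I}}$ defined by $X^+:=X$ on objects and, for a simplicial relation $t\subseteq|X|\times|Y|$ from $X$ to $Y$, by letting $t^+:|X|\to\mathcal{S}Y$ be the function $t^+(a):=\{b\in|Y| \mid (a,b)\in t\}$.
   Context: An abstract simplicial complex (asc) $X$ consists of an at most countable set $|X|$ (the web, whose elements are the vertices) and a set $\mathcal{S}X$ (the simplices) of finite nonempty subsets of $|X|$ which is downward closed (every nonempty subset of an element of $\mathcal{S}X$ is in $\mathcal{S}X$) and contains all singletons $\{a\}$ with $a\in|X|$. A simplicial map from $X$ to $Y$ is a function $f:|X|\to|Y|$ such that $f(\sigma)\in\mathcal{S}Y$ for every $\sigma\in\mathcal{S}X$; $\mathrm{ASC}$ is the category of asc's and simplicial maps. A simplicial relation from $X$ to $Y$ is a subset $t\subseteq|X|\times|Y|$ such that $t\cdot\sigma\in\mathcal{S}Y$ for all $\sigma\in\mathcal{S}X$, where $t\cdot\sigma:=\bigcup_{a\in\sigma}\{b\in|Y|\mid(a,b)\in t\}$ (in particular $t\cdot\sigma$ is required to be finite and nonempty). $\mathrm{RelASC}$ has asc's as objects and simplicial relations as morphisms,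 with the usual composition of relations $t\circ s=\{(a,c)\mid\exists b,\ (a,b)\in s,\ (b,c)\in t\}$ and diagonal relations as identities. The monad $(\mathscr{I},\varepsilon,\mu)$ on $\mathrm{ASC}$ is: $\mathscr{I}X$ is the asc with web $\mathcal{S}X$ whose simplices are the finite nonempty sets $\{u_0,\dots,u_k\}\subseteq\mathcal{S}X$ with $\bigcup_{i=0}^k u_i\in\mathcal{S}X$; $\mathscr{I}f(u):=f(u)$ (direct image); unit $\varepsilon_X(a):=\{a\}$; multiplication $\mu_X(U):=\bigcup_{u\in U}u$. Its Kleisli category $\mathrm{ASC}_{\mathscr{I}}$ has asc's as objects; a morphism from $X$ to $Y$ is a simplicial map from $X$ to $\mathscr{I}Y$; the composite of $f:X\to\mathscr{I}Y$ and $g:Y\to\mathscr{I}Z$ is $\mu_Z\circ\mathscr{I}g\circ f$, and the identity of $X$ is $\varepsilon_X$. *)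

theory Defs
  imports Main "HOL-Library.FuncSet" "HOL-Library.Countable_Set"
begin

section \<open>Categories, functors, equivalences\<close>

text \<open>
  Categories are given by hom-families. The same HOL value may belong to several
  hom-sets (a relation or a function does not determine its codomain), hence
  composition takes the three objects involved as arguments:
  \<open>Comp C X Y Z g f\<close> is \<open>g\<close> after \<open>f\<close>, for \<open>f\<close> from \<open>X\<close> to \<open>Y\<close> and \<open>g\<close> from \<open>Y\<close> to \<open>Z\<close>.
\<close>

record ('o, 'm) cat =
  Obj :: "'o set"
  Hom :: "'o \<Rightarrow> 'o \<Rightarrow> 'm set"
  Id :: "'o \<Rightarrow> 'm"
  Comp :: "'o \<Rightarrow> 'o \<Rightarrow> 'o \<Rightarrow> 'm \<Rightarrow> 'm \<Rightarrow> 'm"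

definition is_category :: "('o, 'm) cat \<Rightarrow> bool" where
  "is_category C \<longleftrightarrow>
     (\<forall>X\<in>Obj C. Id C X \<in> Hom C X X) \<and>
     (\<forall>X\<in>Obj C. \<forall>Y\<in>Obj C. \<forall>Z\<in>Obj C. \<forall>f\<in>Hom C X Y. \<forall>g\<in>Hom C Y Z.
        Comp C X Y Z g f \<in> Hom C X Z) \<and>
     (\<forall>X\<in>Obj C. \<forall>Y\<in>Obj C. \<forall>f\<in>Hom C X Y.
        Comp C X X Y f (Id C X) = f \<and> Comp C X Y Y (Id C Y) f = f) \<and>
     (\<forall>W\<in>Obj C. \<forall>X\<in>Obj C. \<forall>Y\<in>Obj C. \<forall>Z\<in>Obj C.
        \<forall>f\<in>Hom C W X. \<forall>g\<in>Hom C X Y. \<forall>h\<in>Hom C Y Z.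
        Comp C W Y Z h (Comp C W X Y g f) = Comp C W X Z (Comp C X Y Z h g) f)"

record ('o, 'm, 'p, 'n) fctr =
  obj_map :: "'o \<Rightarrow> 'p"
  mor_map :: "'o \<Rightarrow> 'o \<Rightarrow> 'm \<Rightarrow> 'n"

definition is_functor :: "('o, 'm) cat \<Rightarrow> ('p, 'n) cat \<Rightarrow> ('o, 'm, 'p, 'n) fctr \<Rightarrow> bool" where
  "is_functor C D F \<longleftrightarrow>
     is_category C \<and> is_category D \<and>
     (\<forall>X\<in>Obj C. obj_map F X \<in> Obj D) \<and>
     (\<forall>X\<in>Obj C. \<forall>Y\<in>Obj C. \<forall>f\<in>Hom C X Y.
        mor_map F X Y f \<in> Hom D (obj_map F X) (obj_map F Y)) \<and>
     (\<forall>X\<in>Obj C. mor_map F X X (Id C X) = Id D (obj_map F X)) \<and>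
     (\<forall>X\<in>Obj C. \<forall>Y\<in>Obj C. \<forall>Z\<in>Obj C. \<forall>f\<in>Hom C X Y. \<forall>g\<in>Hom C Y Z.
        mor_map F X Z (Comp C X Y Z g f) =
        Comp D (obj_map F X) (obj_map F Y) (obj_map F Z) (mor_map F Y Z g) (mor_map F X Y f))"

definition id_fctr :: "('o, 'm, 'o, 'm) fctr" where
  "id_fctr = \<lparr>obj_map = (\<lambda>X. X), mor_map = (\<lambda>X Y f. f)\<rparr>"

definition comp_fctr ::
  "('p, 'n, 'q, 'k) fctr \<Rightarrow> ('o, 'm, 'p, 'n) fctr \<Rightarrow> ('o, 'm, 'q, 'k) fctr" where
  "comp_fctr G F =
     \<lparr>obj_map = (\<lambda>X. obj_map G (obj_map F X)),
      mor_map = (\<lambda>X Y f. mor_map G (obj_map F X) (obj_map F Y) (mor_map F X Y f))\<rparr>"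

definition is_iso :: "('o, 'm) cat \<Rightarrow> 'o \<Rightarrow> 'o \<Rightarrow> 'm \<Rightarrow> bool" where
  "is_iso C X Y f \<longleftrightarrow>
     f \<in> Hom C X Y \<and>
     (\<exists>g\<in>Hom C Y X. Comp C X Y X g f = Id C X \<and> Comp C Y X Y f g = Id C Y)"

definition is_nat_iso ::
  "('o, 'm) cat \<Rightarrow> ('p, 'n) cat \<Rightarrow> ('o, 'm, 'p, 'n) fctr \<Rightarrow> ('o, 'm, 'p, 'n) fctr \<Rightarrow> ('o \<Rightarrow> 'n) \<Rightarrow> bool"
where
  "is_nat_iso C D F G \<alpha> \<longleftrightarrow>
     (\<forall>X\<in>Obj C. is_iso D (obj_map F X) (obj_map G X) (\<alpha> X)) \<and>
     (\<forall>X\<in>Obj C. \<forall>Y\<in>Obj C. \<forall>f\<in>Hom C X Y.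
        Comp D (obj_map F X) (obj_map F Y) (obj_map G Y) (\<alpha> Y) (mor_map F X Y f) =
        Comp D (obj_map F X) (obj_map G X) (obj_map G Y) (mor_map G X Y f) (\<alpha> X))"

definition is_equivalence :: "('o, 'm) cat \<Rightarrow> ('p, 'n) cat \<Rightarrow> ('o, 'm, 'p, 'n) fctr \<Rightarrow> bool" where
  "is_equivalence C D F \<longleftrightarrow>
     is_functor C D F \<and>
     (\<exists>G \<eta> \<epsilon>. is_functor D C G \<and>
        is_nat_iso C C id_fctr (comp_fctr G F) \<eta> \<and>
        is_nat_iso D D (comp_fctr F G) id_fctr \<epsilon>)"


section \<open>Abstract simplicial complexes\<close>

record 'a asc =
  web :: "'a set"
  simplices :: "'a set set"

definition is_asc :: "'a asc \<Rightarrow> bool" where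
  "is_asc X \<longleftrightarrow>
     countable (web X) \<and>
     (\<forall>\<sigma>\<in>simplices X. finite \<sigma> \<and> \<sigma> \<noteq> {} \<and> \<sigma> \<subseteq> web X) \<and>
     (\<forall>\<sigma>\<in>simplices X. \<forall>\<tau>. \<tau> \<noteq> {} \<and> \<tau> \<subseteq> \<sigma> \<longrightarrow> \<tau> \<in> simplices X) \<and>
     (\<forall>a\<in>web X. {a} \<in> simplices X)"

lemma is_ascD:
  assumes "is_asc X"
  shows "countable (web X)"
    and "\<sigma> \<in> simplices X \<Longrightarrow> finite \<sigma>"
    and "\<sigma> \<in> simplices X \<Longrightarrow> \<sigma> \<noteq> {}"
    and "\<sigma> \<in> simplices X \<Longrightarrow> \<sigma> \<subseteq> web X"
    and "a \<in> web X \<Longrightarrow> {a} \<in> simplices X"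
  using assms unfolding is_asc_def by blast+

lemma is_asc_subsimplex:
  "\<lbrakk>is_asc X; \<sigma> \<in> simplices X; \<tau> \<noteq> {}; \<tau> \<subseteq> \<sigma>\<rbrakk> \<Longrightarrow> \<tau> \<in> simplices X"
  unfolding is_asc_def by blast

text \<open>
  Functions between webs are elements of \<open>\<rightarrow>\<^sub>E\<close> (undefined outside the domain), so that
  equality of morphisms is equality on the web.
\<close>

definition simplicial_maps :: "'a asc \<Rightarrow> 'b asc \<Rightarrow> ('a \<Rightarrow> 'b) set" where
  "simplicial_maps X Y =
     {f \<in> web X \<rightarrow>\<^sub>E web Y. \<forall>\<sigma>\<in>simplices X. f ` \<sigma> \<in> simplices Y}"

definition simplicial_relations :: "'a asc \<Rightarrow> 'b asc \<Rightarrow> ('a \<times> 'b) set set" where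
  "simplicial_relations X Y =
     {t. t \<subseteq> web X \<times> web Y \<and> (\<forall>\<sigma>\<in>simplices X. t `` \<sigma> \<in> simplices Y)}"

text \<open>
  The type of vertices of the objects is an arbitrary type \<open>'a\<close>. Note that \<open>s O t\<close> is
  in diagrammatic order.
\<close>

definition RelASC :: "('a asc, ('a \<times> 'a) set) cat" where
  "RelASC =
     \<lparr>Obj = {X. is_asc X},
      Hom = simplicial_relations,
      Id = (\<lambda>X. Id_on (web X)),
      Comp = (\<lambda>X Y Z t s. s O t)\<rparr>"


section \<open>The monad and its Kleisli category\<close>

definition I_asc :: "'a asc \<Rightarrow> 'a set asc" where
  "I_asc X =
     \<lparr>web = simplices X,
      simplices = {U. finite U \<and> U \<noteq> {} \<and> U \<subseteq> simplices X \<and> \<Union>U \<in> simplices X}\<rparr>"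

definition I_map :: "'a asc \<Rightarrow> ('a \<Rightarrow> 'b) \<Rightarrow> 'a set \<Rightarrow> 'b set" where
  "I_map X f = (\<lambda>u\<in>web (I_asc X). f ` u)"

definition I_unit :: "'a asc \<Rightarrow> 'a \<Rightarrow> 'a set" where
  "I_unit X = (\<lambda>a\<in>web X. {a})"

definition I_mult :: "'a asc \<Rightarrow> 'a set set \<Rightarrow> 'a set" where
  "I_mult X = (\<lambda>U\<in>web (I_asc (I_asc X)). \<Union>U)"

text \<open>
  Since \<open>I_asc\<close> changes the type of vertices, the monad cannot be an endofunctor on a
  \<open>cat\<close> with a fixed type of objects. The functor and monad laws are therefore recorded
  here polymorphically.
\<close>

lemma is_asc_I_asc: "is_asc X \<Longrightarrow> is_asc (I_asc X)"
proof -
  assume X: "is_asc X"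
  have "countable {A. finite A \<and> A \<subseteq> web X}"
    using X by (intro countable_Collect_finite_subset) (simp add: is_asc_def)
  moreover have "simplices X \<subseteq> {A. finite A \<and> A \<subseteq> web X}"
    using X by (auto simp: is_asc_def)
  ultimately have c: "countable (simplices X)"
    using countable_subset by blast
  have d: "\<tau> \<in> simplices (I_asc X)"
    if U: "U \<in> simplices (I_asc X)" and t: "\<tau> \<noteq> {}" "\<tau> \<subseteq> U" for U \<tau>
  proof -
    have "\<tau> \<subseteq> simplices X" "finite \<tau>"
      using U t by (auto simp: I_asc_def intro: finite_subset)
    moreover have "\<Union>\<tau> \<noteq> {}"
    proof -
      obtain u where u: "u \<in> \<tau>" using t by blast
      then have "u \<noteq> {}" using X \<open>\<tau> \<subseteq> simplices X\<close> by (auto simp: is_asc_def)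
      then show ?thesis using u by blast
    qed
    moreover have "\<Union>\<tau> \<subseteq> \<Union>U" "\<Union>U \<in> simplices X"
      using U t by (auto simp: I_asc_def)
    ultimately show ?thesis
      using t is_asc_subsimplex [OF X] by (simp add: I_asc_def)
  qed
  show ?thesis
    unfolding is_asc_def
  proof (intro conjI ballI allI impI)
    show "countable (web (I_asc X))" using c by (simp add: I_asc_def)
    show "finite U" "U \<noteq> {}" "U \<subseteq> web (I_asc X)" if "U \<in> simplices (I_asc X)" for U
      using that by (simp_all add: I_asc_def)
    show "\<tau> \<in> simplices (I_asc X)" if "U \<in> simplices (I_asc X)" "\<tau> \<noteq> {} \<and> \<tau> \<subseteq> U" for U \<tau>
      using d that by blast
    show "{u} \<in> simplices (I_asc X)" if "u \<in> web (I_asc X)" for u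
      using that by (simp add: I_asc_def)
  qed
qed

lemma I_map_simplicial:
  "f \<in> simplicial_maps X Y \<Longrightarrow> I_map X f \<in> simplicial_maps (I_asc X) (I_asc Y)"
proof -
  assume f: "f \<in> simplicial_maps X Y"
  have "I_map X f ` U \<in> simplices (I_asc Y)" if "U \<in> simplices (I_asc X)" for U
  proof -
    have U: "finite U" "U \<noteq> {}" "U \<subseteq> simplices X" "\<Union>U \<in> simplices X"
      using that by (auto simp: I_asc_def)
    have "I_map X f ` U = (`) f ` U"
      using U by (intro image_cong) (auto simp: I_map_def I_asc_def)
    moreover have "\<Union>((`) f ` U) = f ` \<Union>U" by blast
    ultimately show ?thesis
      using U f by (auto simp: I_asc_def simplicial_maps_def)
  qed
  then show ?thesis
    using f by (auto simp: simplicial_maps_def I_map_def I_asc_def)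
qed

lemma I_unit_simplicial: "is_asc X \<Longrightarrow> I_unit X \<in> simplicial_maps X (I_asc X)"
proof -
  assume X: "is_asc X"
  have "I_unit X ` \<sigma> \<in> simplices (I_asc X)" if s: "\<sigma> \<in> simplices X" for \<sigma>
  proof -
    have w: "\<sigma> \<subseteq> web X" "finite \<sigma>" "\<sigma> \<noteq> {}" using is_ascD [OF X] s by auto
    then have "I_unit X ` \<sigma> = (\<lambda>a. {a}) ` \<sigma>"
      by (intro image_cong) (auto simp: I_unit_def)
    moreover have "\<Union>((\<lambda>a. {a}) ` \<sigma>) = \<sigma>" by blast
    moreover have "(\<lambda>a. {a}) ` \<sigma> \<subseteq> simplices X"
      using is_ascD(5) [OF X] w by blast
    ultimately show ?thesis
      using s w by (simp add: I_asc_def)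
  qed
  then show ?thesis
    using is_ascD(5) [OF X] by (auto simp: simplicial_maps_def I_unit_def I_asc_def)
qed

lemma I_mult_simplicial: "I_mult X \<in> simplicial_maps (I_asc (I_asc X)) (I_asc X)"
proof -
  have "I_mult X ` W \<in> simplices (I_asc X)" if W: "W \<in> simplices (I_asc (I_asc X))" for W
  proof -
    have "I_mult X ` W = Union ` W"
      using W by (intro image_cong) (auto simp: I_mult_def I_asc_def)
    moreover have "\<Union>(Union ` W) = \<Union>(\<Union>W)" by blast
    ultimately show ?thesis
      using W by (auto simp: I_asc_def)
  qed
  then show ?thesis
    by (auto simp: simplicial_maps_def I_mult_def I_asc_def)
qed

lemma I_map_id:
  assumes "is_asc X"
  shows "I_map X (\<lambda>a\<in>web X. a) = (\<lambda>u\<in>web (I_asc X). u)"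
proof
  fix u
  have "restrict (\<lambda>a. a) (web X) ` u = u" if "u \<in> simplices X"
  proof -
    have "u \<subseteq> web X" using that assms by (auto simp: is_asc_def)
    then show ?thesis by force
  qed
  then show "I_map X (\<lambda>a\<in>web X. a) u = (\<lambda>u\<in>web (I_asc X). u) u"
    by (auto simp: I_map_def I_asc_def restrict_def)
qed

lemma I_map_compose:
  assumes "is_asc X" "f \<in> simplicial_maps X Y" "g \<in> simplicial_maps Y Z"
  shows "I_map X (compose (web X) g f) = compose (web (I_asc X)) (I_map Y g) (I_map X f)"
proof
  fix u
  have "compose (web X) g f ` u = g ` f ` u" if "u \<in> simplices X"
  proof -
    have "u \<subseteq> web X" using that assms by (auto simp: is_asc_def)
    then show ?thesis by (force simp: compose_def)
  qed
  then show "I_map X (compose (web X) g f) u = compose (web (I_asc X)) (I_map Y g) (I_map X f) u"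
    using assms(2) by (auto simp: I_map_def I_asc_def compose_def simplicial_maps_def)
qed

lemma I_unit_natural:
  assumes "is_asc X" "f \<in> simplicial_maps X Y"
  shows "compose (web X) (I_unit Y) f = compose (web X) (I_map X f) (I_unit X)"
  using assms by (intro ext)
    (auto simp: compose_def I_unit_def I_map_def I_asc_def simplicial_maps_def is_asc_def)

lemma I_mult_natural:
  assumes "f \<in> simplicial_maps X Y"
  shows "compose (web (I_asc (I_asc X))) (I_mult Y) (I_map (I_asc X) (I_map X f)) =
         compose (web (I_asc (I_asc X))) (I_map X f) (I_mult X)"
proof
  fix U
  show "compose (web (I_asc (I_asc X))) (I_mult Y) (I_map (I_asc X) (I_map X f)) U =
        compose (web (I_asc (I_asc X))) (I_map X f) (I_mult X) U"
  proof (cases "U \<in> web (I_asc (I_asc X))")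
    case True
    have m: "I_map (I_asc X) (I_map X f) \<in> simplicial_maps (I_asc (I_asc X)) (I_asc (I_asc Y))"
      using assms by (intro I_map_simplicial)
    have "U \<subseteq> simplices X" "\<Union>U \<in> simplices X" using True by (auto simp: I_asc_def)
    then have "\<Union>(I_map X f ` U) = f ` \<Union>U"
      by (fastforce simp: I_map_def I_asc_def)
    moreover have "I_map (I_asc X) (I_map X f) U \<in> web (I_asc (I_asc Y))"
      using m True by (auto simp: simplicial_maps_def)
    ultimately show ?thesis
      using True \<open>\<Union>U \<in> simplices X\<close>
      by (simp add: compose_def I_mult_def)
         (simp add: I_map_def I_asc_def)
  qed (simp add: compose_def)
qed

lemma I_unit_left:
  "compose (web (I_asc X)) (I_mult X) (I_unit (I_asc X)) = (\<lambda>u\<in>web (I_asc X). u)"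
  by (intro ext) (auto simp: compose_def I_mult_def I_unit_def I_asc_def)

lemma I_unit_right:
  assumes "is_asc X"
  shows "compose (web (I_asc X)) (I_mult X) (I_map X (I_unit X)) = (\<lambda>u\<in>web (I_asc X). u)"
proof
  fix u
  show "compose (web (I_asc X)) (I_mult X) (I_map X (I_unit X)) u = (\<lambda>u\<in>web (I_asc X). u) u"
  proof (cases "u \<in> web (I_asc X)")
    case True
    have m: "I_map X (I_unit X) \<in> simplicial_maps (I_asc X) (I_asc (I_asc X))"
      using assms by (intro I_map_simplicial I_unit_simplicial)
    have "u \<subseteq> web X" using True assms by (auto simp: I_asc_def is_asc_def)
    then have "\<Union>(I_unit X ` u) = u" by (force simp: I_unit_def)
    moreover have "I_map X (I_unit X) u \<in> web (I_asc (I_asc X))"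
      using m True by (auto simp: simplicial_maps_def)
    ultimately show ?thesis
      using True by (simp add: compose_def I_mult_def) (simp add: I_map_def)
  qed (simp add: compose_def)
qed

lemma I_mult_assoc:
  "compose (web (I_asc (I_asc (I_asc X)))) (I_mult X) (I_mult (I_asc X)) =
   compose (web (I_asc (I_asc (I_asc X)))) (I_mult X) (I_map (I_asc (I_asc X)) (I_mult X))"
proof
  fix W
  show "compose (web (I_asc (I_asc (I_asc X)))) (I_mult X) (I_mult (I_asc X)) W =
   compose (web (I_asc (I_asc (I_asc X)))) (I_mult X) (I_map (I_asc (I_asc X)) (I_mult X)) W"
  proof (cases "W \<in> web (I_asc (I_asc (I_asc X)))")
    case True
    have m: "I_map (I_asc (I_asc X)) (I_mult X)
        \<in> simplicial_maps (I_asc (I_asc (I_asc X))) (I_asc (I_asc X))"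
      by (intro I_map_simplicial I_mult_simplicial)
    have n: "I_mult (I_asc X) \<in> simplicial_maps (I_asc (I_asc (I_asc X))) (I_asc (I_asc X))"
      by (rule I_mult_simplicial)
    have "W \<subseteq> web (I_asc (I_asc X))" using True by (auto simp: I_asc_def)
    then have "I_mult X ` W = Union ` W"
      by (intro image_cong) (auto simp: I_mult_def)
    then have "\<Union>(I_mult X ` W) = \<Union>(\<Union>W)" by (simp only:) blast
    moreover have "I_map (I_asc (I_asc X)) (I_mult X) W \<in> web (I_asc (I_asc X))"
      "I_mult (I_asc X) W \<in> web (I_asc (I_asc X))"
      using m n True by (auto simp: simplicial_maps_def)
    moreover have "I_mult (I_asc X) W = \<Union>W"
      "I_map (I_asc (I_asc X)) (I_mult X) W = I_mult X ` W"
      using True by (simp_all add: I_mult_def I_map_def)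
    ultimately show ?thesis
      using True by (simp add: compose_def I_mult_def [of X])
  qed (simp add: compose_def)
qed

definition ASC_I :: "('a asc, 'a \<Rightarrow> 'a set) cat" where
  "ASC_I =
     \<lparr>Obj = {X. is_asc X},
      Hom = (\<lambda>X Y. simplicial_maps X (I_asc Y)),
      Id = I_unit,
      Comp = (\<lambda>X Y Z g f.
        compose (web X) (I_mult Z) (compose (web X) (I_map Y g) f))\<rparr>"


section \<open>The functor from relations to Kleisli maps\<close>

definition plus_mor :: "'a asc \<Rightarrow> 'b asc \<Rightarrow> ('a \<times> 'b) set \<Rightarrow> 'a \<Rightarrow> 'b set" where
  "plus_mor X Y t = (\<lambda>a\<in>web X. {b \<in> web Y. (a, b) \<in> t})"

definition plus_fctr :: "('a asc, ('a \<times> 'a) set, 'a asc, 'a \<Rightarrow> 'a set) fctr" where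
  "plus_fctr = \<lparr>obj_map = (\<lambda>X. X), mor_map = plus_mor\<rparr>"

end

theory Submission
  imports Defs
begin

text \<open>
  The functor is the identity on objects, so it is an equivalence (even an isomorphism of
  categories) as soon as it is bijective on hom-sets. The inverse of \<open>t \<mapsto> t\<^sup>+\<close> sends a Kleisli map
  \<open>f\<close> to its graph \<open>{(a, b). b \<in> f a}\<close>: since \<open>t `` \<sigma> = \<Union>(t\<^sup>+ ` \<sigma>)\<close>, the relation \<open>t\<close> is simplicial
  exactly when \<open>t\<^sup>+\<close> is a simplicial map into \<open>\<I>Y\<close>. The category laws of the Kleisli category
  are transported along these bijections from those of relations.
\<close>

text \<open>Every morphism of \<open>D\<close> is the image under \<open>m\<close> of one of
  \<open>C\<close>. Reading \<open>comp\<close> and \<open>ident\<close> from right to left turns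
  each law of \<open>D\<close> into the image of the same law of \<open>C\<close>. With
  \<open>D\<close> the Kleisli category, its associativity comes from that of relational
  composition.\<close>

lemma is_category_transfer:
  assumes C: "is_category C"
    and obj: "Obj D = Obj C"
    and bij: "\<And>X Y. X \<in> Obj C \<Longrightarrow> Y \<in> Obj C \<Longrightarrow> bij_betw (m X Y) (Hom C X Y) (Hom D X Y)"
    and ident: "\<And>X. X \<in> Obj C \<Longrightarrow> m X X (Id C X) = Id D X"
    and comp: "\<And>X Y Z f g. X \<in> Obj C \<Longrightarrow> Y \<in> Obj C \<Longrightarrow> Z \<in> Obj C \<Longrightarrow>
      f \<in> Hom C X Y \<Longrightarrow> g \<in> Hom C Y Z \<Longrightarrow>
      m X Z (Comp C X Y Z g f) = Comp D X Y Z (m Y Z g) (m X Y f)"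
  shows "is_category D"
proof -
  have id_in: "Id C X \<in> Hom C X X" if "X \<in> Obj C" for X
    using C that by (simp add: is_category_def)
  have comp_in: "Comp C X Y Z g f \<in> Hom C X Z"
    if "X \<in> Obj C" "Y \<in> Obj C" "Z \<in> Obj C" "f \<in> Hom C X Y" "g \<in> Hom C Y Z" for X Y Z f g
    using C that by (simp add: is_category_def)
  have unit: "Comp C X X Y f (Id C X) = f" "Comp C X Y Y (Id C Y) f = f"
    if "X \<in> Obj C" "Y \<in> Obj C" "f \<in> Hom C X Y" for X Y f
    using C that by (simp_all add: is_category_def)
  have assoc: "Comp C W Y Z h (Comp C W X Y g f) = Comp C W X Z (Comp C X Y Z h g) f"
    if "W \<in> Obj C" "X \<in> Obj C" "Y \<in> Obj C" "Z \<in> Obj C"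
      "f \<in> Hom C W X" "g \<in> Hom C X Y" "h \<in> Hom C Y Z" for W X Y Z f g h
    using C that unfolding is_category_def by blast
  have m_in: "m X Y f \<in> Hom D X Y" if "X \<in> Obj C" "Y \<in> Obj C" "f \<in> Hom C X Y" for X Y f
    using bij that by (blast intro: bij_betwE [THEN bspec])
  have lift: "\<exists>f'\<in>Hom C X Y. f = m X Y f'" if "X \<in> Obj C" "Y \<in> Obj C" "f \<in> Hom D X Y" for X Y f
    using bij [of X Y] that by (auto simp: bij_betw_def)
  show ?thesis
    unfolding is_category_def obj
  proof (intro conjI ballI)
    fix X assume "X \<in> Obj C"
    then show "Id D X \<in> Hom D X X"
      using m_in id_in ident by metis
  next
    fix X Y Z f g
    assume o: "X \<in> Obj C" "Y \<in> Obj C" "Z \<in> Obj C" and f: "f \<in> Hom D X Y" and g: "g \<in> Hom D Y Z"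
    obtain f' g' where "f' \<in> Hom C X Y" "f = m X Y f'" "g' \<in> Hom C Y Z" "g = m Y Z g'"
      using lift o f g by metis
    then show "Comp D X Y Z g f \<in> Hom D X Z"
      using o by (simp add: comp_in m_in flip: comp)
  next
    fix X Y f
    assume o: "X \<in> Obj C" "Y \<in> Obj C" and f: "f \<in> Hom D X Y"
    obtain f' where "f' \<in> Hom C X Y" "f = m X Y f'"
      using lift o f by metis
    then show "Comp D X X Y f (Id D X) = f" "Comp D X Y Y (Id D Y) f = f"
      using o by (simp_all add: id_in unit flip: comp ident)
  next
    fix W X Y Z f g h
    assume o: "W \<in> Obj C" "X \<in> Obj C" "Y \<in> Obj C" "Z \<in> Obj C"
      and f: "f \<in> Hom D W X" and g: "g \<in> Hom D X Y" and h: "h \<in> Hom D Y Z"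
    obtain f' where "f' \<in> Hom C W X" "f = m W X f'" using lift o f by metis
    moreover obtain g' where "g' \<in> Hom C X Y" "g = m X Y g'" using lift o g by metis
    moreover obtain h' where "h' \<in> Hom C Y Z" "h = m Y Z h'" using lift o h by metis
    ultimately show "Comp D W Y Z h (Comp D W X Y g f) = Comp D W X Z (Comp D X Y Z h g) f"
      using o by (simp add: comp_in assoc flip: comp)
  qed
qed

text \<open>An identity is its own inverse, and the naturality squares reduce to the unit laws. The
  hypotheses are pointwise because a functor composed with its inverse fixes morphisms inside the
  hom-sets only, not as a HOL function.\<close>

lemma is_nat_iso_identity:
  assumes C: "is_category C"
    and obj: "\<And>X. X \<in> Obj C \<Longrightarrow> obj_map F X = X" "\<And>X. X \<in> Obj C \<Longrightarrow> obj_map G X = X"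
    and mor: "\<And>X Y f. X \<in> Obj C \<Longrightarrow> Y \<in> Obj C \<Longrightarrow> f \<in> Hom C X Y \<Longrightarrow> mor_map F X Y f = f"
      "\<And>X Y f. X \<in> Obj C \<Longrightarrow> Y \<in> Obj C \<Longrightarrow> f \<in> Hom C X Y \<Longrightarrow> mor_map G X Y f = f"
  shows "is_nat_iso C C F G (Id C)"
  using C obj mor by (auto simp: is_nat_iso_def is_iso_def is_category_def)

text \<open>The quasi-inverse is again the identity on objects and inverts \<open>m\<close> on each
  hom-set; unit and counit are identities.\<close>

lemma is_equivalence_identity_on_objects:
  assumes C: "is_category C"
    and obj: "Obj D = Obj C"
    and bij: "\<And>X Y. X \<in> Obj C \<Longrightarrow> Y \<in> Obj C \<Longrightarrow> bij_betw (m X Y) (Hom C X Y) (Hom D X Y)"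
    and ident: "\<And>X. X \<in> Obj C \<Longrightarrow> m X X (Id C X) = Id D X"
    and comp: "\<And>X Y Z f g. X \<in> Obj C \<Longrightarrow> Y \<in> Obj C \<Longrightarrow> Z \<in> Obj C \<Longrightarrow>
      f \<in> Hom C X Y \<Longrightarrow> g \<in> Hom C Y Z \<Longrightarrow>
      m X Z (Comp C X Y Z g f) = Comp D X Y Z (m Y Z g) (m X Y f)"
  shows "is_equivalence C D \<lparr>obj_map = (\<lambda>X. X), mor_map = m\<rparr>"
proof -
  define n where "n = (\<lambda>X Y. inv_into (Hom C X Y) (m X Y))"
  have D: "is_category D"
    using is_category_transfer [of C D m] assms by blast
  have m_in: "m X Y f \<in> Hom D X Y" if "X \<in> Obj C" "Y \<in> Obj C" "f \<in> Hom C X Y" for X Y f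
    using bij that by (blast intro: bij_betwE [THEN bspec])
  have n_in: "n X Y f \<in> Hom C X Y" if "X \<in> Obj C" "Y \<in> Obj C" "f \<in> Hom D X Y" for X Y f
    using bij [of X Y] that by (auto simp: n_def bij_betw_def intro: inv_into_into)
  have nm: "n X Y (m X Y f) = f" if "X \<in> Obj C" "Y \<in> Obj C" "f \<in> Hom C X Y" for X Y f
    using bij [of X Y] that by (simp add: n_def bij_betw_inv_into_left)
  have mn: "m X Y (n X Y f) = f" if "X \<in> Obj C" "Y \<in> Obj C" "f \<in> Hom D X Y" for X Y f
    using bij [of X Y] that by (simp add: n_def bij_betw_inv_into_right)
  have id_in: "Id C X \<in> Hom C X X" if "X \<in> Obj C" for X
    using C that by (simp add: is_category_def)
  have comp_in: "Comp C X Y Z g f \<in> Hom C X Z"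
    if "X \<in> Obj C" "Y \<in> Obj C" "Z \<in> Obj C" "f \<in> Hom C X Y" "g \<in> Hom C Y Z" for X Y Z f g
    using C that by (simp add: is_category_def)
  have n_id: "n X X (Id D X) = Id C X" if "X \<in> Obj C" for X
    using that by (metis ident nm id_in)
  have n_comp: "n X Z (Comp D X Y Z g f) = Comp C X Y Z (n Y Z g) (n X Y f)"
    if "X \<in> Obj C" "Y \<in> Obj C" "Z \<in> Obj C" "f \<in> Hom D X Y" "g \<in> Hom D Y Z" for X Y Z f g
  proof -
    \<comment> \<open>Once the composite is exhibited as a value of \<open>m\<close>, applying
      \<open>n\<close> to it just strips \<open>m\<close>.\<close>
    have "Comp D X Y Z g f = m X Z (Comp C X Y Z (n Y Z g) (n X Y f))"
      using that by (simp add: comp n_in mn)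
    then show ?thesis
      using that by (simp add: nm comp_in n_in)
  qed
  let ?F = "\<lparr>obj_map = (\<lambda>X. X), mor_map = m\<rparr>" and ?G = "\<lparr>obj_map = (\<lambda>X. X), mor_map = n\<rparr>"
  have "is_functor C D ?F"
    using C D by (simp add: is_functor_def obj m_in ident comp)
  moreover have "is_functor D C ?G"
    using C D by (simp add: is_functor_def obj n_in n_id n_comp)
  moreover have "is_nat_iso C C id_fctr (comp_fctr ?G ?F) (Id C)"
    by (rule is_nat_iso_identity [OF C]) (simp_all add: id_fctr_def comp_fctr_def nm)
  moreover have "is_nat_iso D D (comp_fctr ?F ?G) id_fctr (Id D)"
    by (rule is_nat_iso_identity [OF D]) (simp_all add: id_fctr_def comp_fctr_def obj mn)
  ultimately show ?thesis
    unfolding is_equivalence_def by blast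
qed

text \<open>Closure under composition holds since the image of a simplex under \<open>s O t\<close>
  is its image under \<open>s\<close>, then \<open>t\<close>. The unit laws use that relations stay
  within the webs.\<close>

lemma is_category_RelASC: "is_category RelASC"
proof -
  have "Id_on (web X) `` \<sigma> = \<sigma>" if "is_asc X" "\<sigma> \<in> simplices X" for X :: "'a asc" and \<sigma>
    using is_ascD(4) [OF that] by auto
  moreover have "s O Id_on (web Y) = s" "Id_on (web X) O s = s"
    if "s \<in> simplicial_relations X Y" for X Y :: "'a asc" and s
    using that by (auto simp: simplicial_relations_def)
  moreover have "s O t \<in> simplicial_relations X Z"
    if "s \<in> simplicial_relations X Y" "t \<in> simplicial_relations Y Z" for X Y Z :: "'a asc" and s t
    using that by (auto simp: simplicial_relations_def relcomp_Image)
  moreover have "Id_on (web X) \<in> simplicial_relations X X" if "is_asc X" for X :: "'a asc"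
    using that calculation(1) by (auto simp: simplicial_relations_def)
  ultimately show ?thesis
    by (simp add: is_category_def RelASC_def O_assoc)
qed

lemma plus_mor_eq_Image:
  assumes "t \<in> simplicial_relations X Y"
  shows "plus_mor X Y t = (\<lambda>a\<in>web X. t `` {a})"
  using assms by (auto simp: plus_mor_def simplicial_relations_def intro!: restrict_ext)

lemma plus_mor_simplicial:
  assumes X: "is_asc X" and t: "t \<in> simplicial_relations X Y"
  shows "plus_mor X Y t \<in> simplicial_maps X (I_asc Y)"
proof -
  have s: "t `` \<sigma> \<in> simplices Y" if "\<sigma> \<in> simplices X" for \<sigma>
    using t that by (simp add: simplicial_relations_def)
  \<comment> \<open>Vertices are simplices, so the values of \<open>plus_mor X Y t\<close> are
    vertices of \<open>I_asc Y\<close>.\<close>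
  have v: "t `` {a} \<in> simplices Y" if "a \<in> web X" for a
    using s is_ascD(5) [OF X that] .
  have "plus_mor X Y t ` \<sigma> \<in> simplices (I_asc Y)" if \<sigma>: "\<sigma> \<in> simplices X" for \<sigma>
  proof -
    have w: "\<sigma> \<subseteq> web X" "finite \<sigma>" "\<sigma> \<noteq> {}"
      using is_ascD [OF X] \<sigma> by auto
    then have "plus_mor X Y t ` \<sigma> = (\<lambda>a. t `` {a}) ` \<sigma>"
      by (intro image_cong) (auto simp: plus_mor_eq_Image [OF t])
    moreover have "\<Union>((\<lambda>a. t `` {a}) ` \<sigma>) = t `` \<sigma>"
      by blast
    ultimately show ?thesis
      using w v s [OF \<sigma>] by (auto simp: I_asc_def)
  qed
  then show ?thesis
    using v by (auto simp: simplicial_maps_def plus_mor_eq_Image [OF t] I_asc_def)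
qed

lemma bij_betw_plus_mor:
  assumes X: "is_asc X" and Y: "is_asc Y"
  shows "bij_betw (plus_mor X Y) (simplicial_relations X Y) (simplicial_maps X (I_asc Y))"
proof (rule bij_betw_byWitness [where f' = "\<lambda>f. Sigma (web X) f"])
  show "\<forall>t\<in>simplicial_relations X Y. Sigma (web X) (plus_mor X Y t) = t"
    by (auto simp: plus_mor_def simplicial_relations_def)
  \<comment> \<open>The restriction to \<open>web Y\<close> in \<open>plus_mor\<close> thus removes
    nothing from \<open>f a\<close>.\<close>
  have sub: "f a \<subseteq> web Y" if "f \<in> simplicial_maps X (I_asc Y)" "a \<in> web X" for f a
    using that is_ascD(4) [OF Y, of "f a"] by (auto simp: simplicial_maps_def I_asc_def PiE_iff)
  show "\<forall>f\<in>simplicial_maps X (I_asc Y). plus_mor X Y (Sigma (web X) f) = f"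
  proof (intro ballI ext)
    fix f a assume "f \<in> simplicial_maps X (I_asc Y)"
    then show "plus_mor X Y (Sigma (web X) f) a = f a"
      using sub [of f a]
      \<comment> \<open>Off the web both sides are \<open>undefined\<close>.\<close>
      by (cases "a \<in> web X") (auto simp: plus_mor_def simplicial_maps_def dest: PiE_arb)
  qed
  show "plus_mor X Y ` simplicial_relations X Y \<subseteq> simplicial_maps X (I_asc Y)"
    using plus_mor_simplicial [OF X] by blast
  have "Sigma (web X) f `` \<sigma> \<in> simplices Y"
    if f: "f \<in> simplicial_maps X (I_asc Y)" and \<sigma>: "\<sigma> \<in> simplices X" for f \<sigma>
  proof -
    have "Sigma (web X) f `` \<sigma> = \<Union>(f ` \<sigma>)"
      using is_ascD(4) [OF X \<sigma>] by auto
    then show ?thesis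
      using f \<sigma> by (simp add: simplicial_maps_def I_asc_def)
  qed
  then show "Sigma (web X) ` simplicial_maps X (I_asc Y) \<subseteq> simplicial_relations X Y"
    using sub by (fastforce simp: simplicial_relations_def)
qed

text \<open>\<open>I_map\<close> and \<open>I_mult\<close> are restricted functions, so the formula
  rests on \<open>f a\<close> and its image under \<open>I_map Y g\<close> lying in their
  domains.\<close>

lemma Comp_ASC_I_eq_Union:
  assumes f: "f \<in> simplicial_maps X (I_asc Y)" and g: "g \<in> simplicial_maps Y (I_asc Z)"
  shows "Comp ASC_I X Y Z g f = (\<lambda>a\<in>web X. \<Union>(g ` f a))"
proof
  fix a
  show "Comp ASC_I X Y Z g f a = (\<lambda>a\<in>web X. \<Union>(g ` f a)) a"
  proof (cases "a \<in> web X")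
    case True
    have fa: "f a \<in> web (I_asc Y)"
      using f True by (auto simp: simplicial_maps_def)
    moreover have "I_map Y g (f a) \<in> web (I_asc (I_asc Z))"
      using I_map_simplicial [OF g] fa by (auto simp: simplicial_maps_def)
    ultimately show ?thesis
      using True by (simp add: ASC_I_def compose_def I_mult_def) (simp add: I_map_def)
  qed (simp add: ASC_I_def compose_def)
qed

lemma plus_mor_Id_on: "plus_mor X X (Id_on (web X)) = I_unit X"
  by (auto simp: plus_mor_def I_unit_def intro!: restrict_ext)

text \<open>The fibre of \<open>s O t\<close> over \<open>a\<close> is the union of the fibres of
  \<open>t\<close> over the points of the fibre of \<open>s\<close> over \<open>a\<close>.\<close>

lemma plus_mor_relcomp:
  fixes X Y Z :: "'a asc"
  assumes X: "is_asc X" and Y: "is_asc Y"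
    and s: "s \<in> simplicial_relations X Y" and t: "t \<in> simplicial_relations Y Z"
  shows "plus_mor X Z (s O t) = Comp ASC_I X Y Z (plus_mor Y Z t) (plus_mor X Y s)"
  unfolding Comp_ASC_I_eq_Union [OF plus_mor_simplicial [OF X s] plus_mor_simplicial [OF Y t]]
  using s t unfolding plus_mor_def simplicial_relations_def
  by (intro restrict_ext) auto

theorem proposition2:
  shows "is_equivalence (RelASC :: ('a asc, ('a \<times> 'a) set) cat) ASC_I plus_fctr"
  unfolding plus_fctr_def
proof (rule is_equivalence_identity_on_objects [OF is_category_RelASC])
  show "Obj (ASC_I :: ('a asc, 'a \<Rightarrow> 'a set) cat) = Obj RelASC"
    by (simp add: ASC_I_def RelASC_def)
\<comment> \<open>\<open>ASC_I\<close> stays folded at first, since \<open>plus_mor_relcomp\<close>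
  is stated with \<open>Comp ASC_I\<close>; it is then unfolded for hom-sets and identities.\<close>
qed (simp_all add: RelASC_def plus_mor_relcomp,
  simp_all add: ASC_I_def bij_betw_plus_mor plus_mor_Id_on)

end
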